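(* Let $k$ be an algebraically closed field of characteristic $0$, $R=k[x,y]$, $\mathfrak m=(x,y)$, and let $L$ be a generic lex-segment ideal of $R$. Then $\operatorname{depth}\operatorname{gr}_L(R)>0$.
   Context: A lex-segment ideal is a monomial ideal $L$ such that whenever $n,m$ are monomials of the same degree with $n>m$ in the lexicographic order (with $x>y$), $m\in L$ implies $n\in L$. For a homogeneous ideal $I$, $\operatorname{Lex}(I)$ is the unique lex-segment ideal with $\dim_k I_s=\dim_k\operatorname{Lex}(I)_s$ for all $s$. An ideal is generic if it is generated by generic forms (i.e. forms with coefficients in a suitable nonempty Zariski-open set) of given degrees $d_1,\dots,d_r$, $r\ge2$, so that it is $\mathfrak m$-primary; a lex-segment ideal $L$ is generic if $L=\operatorname{Lex}(I)$ for such a generic $\mathfrak m$-primary ideal $I$. $\operatorname{gr}_L(R)=\bigoplus_{n\ge0}L^n/L^{n+1}$. *)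

theory Defs
  imports "HOL-Computational_Algebra.Polynomial"
begin

text \<open>
  The polynomial ring R = k[x,y] is modelled as the type 'k poly poly, i.e. (k[y])[x]:
  the outer indeterminate is x, the inner one is y.  The coefficient of x^i y^j in p
  is coeff (coeff p i) j.
\<close>

definition alg_closed_field :: "'k::field itself \<Rightarrow> bool" where
  "alg_closed_field _ \<longleftrightarrow> (\<forall>p :: 'k poly. degree p \<ge> 1 \<longrightarrow> (\<exists>z. poly p z = 0))"

definition varX :: "'k::comm_ring_1 poly poly" where
  "varX = monom 1 1"

definition varY :: "'k::comm_ring_1 poly poly" where
  "varY = monom (monom 1 1) 0"

definition xymon :: "nat \<Rightarrow> nat \<Rightarrow> 'k::comm_ring_1 poly poly" where
  "xymon a b = monom (monom 1 b) a"

definition is_ideal :: "'a::comm_ring_1 set \<Rightarrow> bool" where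
  "is_ideal I \<longleftrightarrow> 0 \<in> I \<and> (\<forall>a\<in>I. \<forall>b\<in>I. a + b \<in> I) \<and> (\<forall>a\<in>I. \<forall>r. r * a \<in> I)"

definition ideal_gen :: "'a::comm_ring_1 set \<Rightarrow> 'a set" where
  "ideal_gen S = \<Inter>{I. is_ideal I \<and> S \<subseteq> I}"

fun ideal_pow :: "'a::comm_ring_1 set \<Rightarrow> nat \<Rightarrow> 'a set" where
  "ideal_pow L 0 = UNIV"
| "ideal_pow L (Suc n) = ideal_gen {a * b | a b. a \<in> L \<and> b \<in> ideal_pow L n}"

definition radical :: "'a::comm_ring_1 set \<Rightarrow> 'a set" where
  "radical I = {f. \<exists>n. f ^ n \<in> I}"

definition max_ideal :: "'k::comm_ring_1 poly poly set" where
  "max_ideal = ideal_gen {varX, varY}"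

definition m_primary :: "'k::comm_ring_1 poly poly set \<Rightarrow> bool" where
  "m_primary I \<longleftrightarrow> is_ideal I \<and> radical I = max_ideal"

definition homogeneous :: "nat \<Rightarrow> 'k::comm_ring_1 poly poly \<Rightarrow> bool" where
  "homogeneous s p \<longleftrightarrow> (\<forall>i j. coeff (coeff p i) j \<noteq> 0 \<longrightarrow> i + j = s)"

definition homogeneous_ideal :: "'k::comm_ring_1 poly poly set \<Rightarrow> bool" where
  "homogeneous_ideal I \<longleftrightarrow> is_ideal I \<and>
     I = ideal_gen {p \<in> I. \<exists>s. homogeneous s p}"

definition graded_part :: "nat \<Rightarrow> 'k::comm_ring_1 poly poly set \<Rightarrow> 'k poly poly set" where
  "graded_part s I = {p \<in> I. homogeneous s p}"

definition kscale :: "'k::comm_ring_1 \<Rightarrow> 'k poly poly \<Rightarrow> 'k poly poly" where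
  "kscale c p = smult [:c:] p"

definition hdim :: "nat \<Rightarrow> 'k::field poly poly set \<Rightarrow> nat" where
  "hdim s I = vector_space.dim kscale (graded_part s I)"

definition monomial_ideal :: "'k::comm_ring_1 poly poly set \<Rightarrow> bool" where
  "monomial_ideal L \<longleftrightarrow> (\<exists>S. L = ideal_gen ((\<lambda>(a, b). xymon a b) ` S))"

text \<open>Lex order with x > y on monomials of the same degree s:
  x^a y^(s-a) > x^b y^(s-b) iff a > b.\<close>
definition lex_segment :: "'k::comm_ring_1 poly poly set \<Rightarrow> bool" where
  "lex_segment L \<longleftrightarrow> monomial_ideal L \<and>
     (\<forall>s a b. b < a \<and> a \<le> s \<longrightarrow> xymon b (s - b) \<in> L \<longrightarrow> xymon a (s - a) \<in> L)"

definition Lex :: "'k::field poly poly set \<Rightarrow> 'k poly poly set" where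
  "Lex I = (THE L. lex_segment L \<and> (\<forall>s. hdim s L = hdim s I))"

text \<open>Parameter space for r forms of degrees d 0, ..., d (r-1): the coefficient
  c i j of x^j y^(d i - j) in the i-th form; all other entries are 0.
  This is affine space k^N, N = sum (d i + 1).\<close>
definition param_space :: "nat \<Rightarrow> (nat \<Rightarrow> nat) \<Rightarrow> (nat \<Rightarrow> nat \<Rightarrow> 'k::zero) set" where
  "param_space r d = {c. \<forall>i j. (r \<le> i \<or> d i < j) \<longrightarrow> c i j = 0}"

inductive polyfun :: "((nat \<Rightarrow> nat \<Rightarrow> 'k::comm_ring_1) \<Rightarrow> 'k) \<Rightarrow> bool" where
  pf_const: "polyfun (\<lambda>c. a)"
| pf_coord: "polyfun (\<lambda>c. c i j)"
| pf_add: "polyfun f \<Longrightarrow> polyfun g \<Longrightarrow> polyfun (\<lambda>c. f c + g c)"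
| pf_mult: "polyfun f \<Longrightarrow> polyfun g \<Longrightarrow> polyfun (\<lambda>c. f c * g c)"

definition zariski_closed :: "(nat \<Rightarrow> nat \<Rightarrow> 'k::comm_ring_1) set \<Rightarrow> (nat \<Rightarrow> nat \<Rightarrow> 'k) set \<Rightarrow> bool" where
  "zariski_closed P Z \<longleftrightarrow> (\<exists>F. (\<forall>f\<in>F. polyfun f) \<and> Z = {c \<in> P. \<forall>f\<in>F. f c = 0})"

definition zariski_open :: "(nat \<Rightarrow> nat \<Rightarrow> 'k::comm_ring_1) set \<Rightarrow> (nat \<Rightarrow> nat \<Rightarrow> 'k) set \<Rightarrow> bool" where
  "zariski_open P U \<longleftrightarrow> U \<subseteq> P \<and> zariski_closed P (P - U)"

definition form_of :: "(nat \<Rightarrow> nat) \<Rightarrow> (nat \<Rightarrow> nat \<Rightarrow> 'k::comm_ring_1) \<Rightarrow> nat \<Rightarrow> 'k poly poly" where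
  "form_of d c i = (\<Sum>j\<le>d i. monom (monom (c i j) (d i - j)) j)"

definition forms_ideal :: "nat \<Rightarrow> (nat \<Rightarrow> nat) \<Rightarrow> (nat \<Rightarrow> nat \<Rightarrow> 'k::comm_ring_1) \<Rightarrow> 'k poly poly set" where
  "forms_ideal r d c = ideal_gen (form_of d c ` {..<r})"

definition generic_lex :: "'k::field poly poly set \<Rightarrow> bool" where
  "generic_lex L \<longleftrightarrow> (\<exists>r d U. 2 \<le> r \<and> zariski_open (param_space r d) U \<and> U \<noteq> {} \<and>
      (\<forall>c\<in>U. m_primary (forms_ideal r d c) \<and> L = Lex (forms_ideal r d c)))"

text \<open>Elements of gr_L(R) = \<Oplus> L^n/L^(n+1) are represented by sequences g with
  g n \<in> L^n, only finitely many of them nonzero modulo L^(n+1).\<close>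
definition gr_elem :: "'a::comm_ring_1 set \<Rightarrow> (nat \<Rightarrow> 'a) \<Rightarrow> bool" where
  "gr_elem L g \<longleftrightarrow> (\<forall>n. g n \<in> ideal_pow L n) \<and> finite {n. g n \<notin> ideal_pow L (Suc n)}"

definition gr_eq :: "'a::comm_ring_1 set \<Rightarrow> (nat \<Rightarrow> 'a) \<Rightarrow> (nat \<Rightarrow> 'a) \<Rightarrow> bool" where
  "gr_eq L g h \<longleftrightarrow> (\<forall>n. g n - h n \<in> ideal_pow L (Suc n))"

definition gr_mult :: "(nat \<Rightarrow> 'a::comm_ring_1) \<Rightarrow> (nat \<Rightarrow> 'a) \<Rightarrow> nat \<Rightarrow> 'a" where
  "gr_mult g h n = (\<Sum>i\<le>n. g i * h (n - i))"

definition gr_zero :: "'a::comm_ring_1 set \<Rightarrow> (nat \<Rightarrow> 'a) \<Rightarrow> bool" where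
  "gr_zero L g \<longleftrightarrow> gr_eq L g (\<lambda>_. 0)"

text \<open>The homogeneous maximal ideal M = m/L \<oplus> L/L^2 \<oplus> ... of gr_L(R).\<close>
definition gr_max :: "'k::comm_ring_1 poly poly set \<Rightarrow> (nat \<Rightarrow> 'k poly poly) set" where
  "gr_max L = {g. gr_elem L g \<and> g 0 \<in> max_ideal}"

definition gr_regular :: "'a::comm_ring_1 set \<Rightarrow> (nat \<Rightarrow> 'a) \<Rightarrow> bool" where
  "gr_regular L u \<longleftrightarrow>
     (\<forall>g. gr_elem L g \<and> gr_zero L (gr_mult u g) \<longrightarrow> gr_zero L g) \<and>
     (\<exists>g. gr_elem L g \<and> \<not> (\<exists>h. gr_elem L h \<and> gr_eq L g (gr_mult u h)))"

definition depth_gr_pos :: "'k::comm_ring_1 poly poly set \<Rightarrow> bool" where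
  "depth_gr_pos L \<longleftrightarrow> (\<exists>u \<in> gr_max L. gr_regular L u)"

end

(*
  For generic forms the Hilbert function of R/I is h(s) = max(0, s + 1 - sum_i max(0, s + 1 - d_i)):
  in each degree maximal rank is attained by suitable monomials, hence generically. So h is concave
  on the range from the initial degree d up to its first zero d + M, except for the last step, and
  Lex(I) is spanned by the x^i y^j with i >= h(i + j).
  For C = h(d) the element u = x^C y^(d - C) + y^(d + M) of L satisfies L^(n+1) : u = L^n for all n,
  so that its initial form in gr_L(R) is a nonzerodivisor of positive degree. Membership of
  x^i y^j in L^n amounts to splitting i + j - n d into n parts whose h-values sum to at most i, and
  concavity makes it optimal to use parts 0, M - 1 and M, with at most one exception.
*)
theory Submission
  imports Defs "Jordan_Normal_Form.Determinant"
begin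

section \<open>Monomial supports\<close>

text \<open>The turning point is n (M - 1). Call the degree of a monomial minus n d its excess, to
  be split into parts whose h-values bound the x-exponent. If n + 1 parts have total at most n (M -
  1), concavity lets them be rearranged until one part is 0, and dropping it undoes the factor x^C
  y^(d - C). If the total is at least n (M - 1) + M, by pigeonhole some part is at least M, and
  shedding it undoes y^(d + M). Hence u has two summands. Concavity stops short of M because h is
  the truncation at 0 of s + 1 minus a sum of convex functions; spreading two parts therefore halts
  at M - 1. Maximal rank is a nonvanishing condition in each single degree, but infinitely many such
  conditions need not define an open set. Two of the forms leave room for all monomials from degree
  d_0 + d_1 on, and a full degree stays full, so finitely many conditions suffice and some point of
  the given open set satisfies all of them.\<close>

definition cf :: "'k::comm_ring_1 poly poly \<Rightarrow> nat \<Rightarrow> nat \<Rightarrow> 'k" where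
  "cf p i j = coeff (coeff p i) j"

lemma cf_0 [simp]: "cf 0 i j = 0"
  and cf_add [simp]: "cf (p + q) i j = cf p i j + cf q i j"
  and cf_diff [simp]: "cf (p - q) i j = cf p i j - cf q i j"
  and cf_kscale [simp]: "cf (kscale c p) i j = c * cf p i j"
  and cf_xymon: "cf (xymon a b) i j = (if i = a \<and> j = b then 1 else 0)"
  by (auto simp: cf_def kscale_def xymon_def)

lemma cf_sum [simp]: "cf (sum f A) i j = (\<Sum>x\<in>A. cf (f x) i j)"
  by (simp add: cf_def coeff_sum)

lemma poly_poly_eqI: "(\<And>i j. cf p i j = cf q i j) \<Longrightarrow> p = q"
  unfolding cf_def by (intro poly_eqI) auto

lemma cf_xymon_mult:
  "cf (xymon a b * p) i j = (if a \<le> i \<and> b \<le> j then cf p (i - a) (j - b) else 0)"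
  by (auto simp: cf_def xymon_def coeff_monom_mult)

lemma xymon_mult: "xymon a b * xymon c e = (xymon (a + c) (b + e) :: 'k::comm_ring_1 poly poly)"
  by (simp add: xymon_def mult_monom)

lemma xymon_0_0: "xymon 0 0 = 1"
  by (simp add: xymon_def monom_0 one_pCons)

lemma cf_mult: "cf (p * q) i j = (\<Sum>k\<le>i. \<Sum>l\<le>j. cf p k l * cf q (i - k) (j - l))"
  by (simp add: cf_def coeff_mult coeff_sum)

lemma cf_mult_nonzero:
  assumes "cf (p * q) i j \<noteq> 0"
  obtains a b c e where "cf p a b \<noteq> 0" "cf q c e \<noteq> 0" "i = a + c" "j = b + e"
proof -
  from assms[unfolded cf_mult] obtain k where "k \<le> i" "(\<Sum>l\<le>j. cf p k l * cf q (i - k) (j - l)) \<noteq> 0"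
    by (metis (no_types, lifting) sum.neutral atMost_iff)
  moreover from this obtain l where "l \<le> j" "cf p k l * cf q (i - k) (j - l) \<noteq> 0"
    by (metis (no_types, lifting) sum.neutral atMost_iff)
  ultimately show thesis
    by (intro that[of k l "i - k" "j - l"]) auto
qed

lemma poly_poly_eq_sum_xymon:
  "p = (\<Sum>i\<le>degree p. \<Sum>j\<le>degree (coeff p i). kscale (cf p i j) (xymon i j))"
proof -
  have "(\<Sum>j\<le>degree (coeff p i). kscale (cf p i j) (xymon i j)) = monom (coeff p i) i" for i
  proof -
    have "(\<Sum>j\<le>degree (coeff p i). kscale (cf p i j) (xymon i j))
        = (\<Sum>j\<le>degree (coeff p i). monom (monom (coeff (coeff p i) j) j) i)"
      by (intro sum.cong refl) (simp add: cf_def kscale_def xymon_def smult_monom)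
    also have "\<dots> = monom (\<Sum>j\<le>degree (coeff p i). monom (coeff (coeff p i) j) j) i"
      by (intro poly_eqI) (simp add: coeff_sum)
    finally show ?thesis
      by (simp add: poly_as_sum_of_monoms)
  qed
  then show ?thesis
    by (simp add: poly_as_sum_of_monoms)
qed

lemma finite_cf_support: "finite {(i, j). cf p i j \<noteq> 0}"
proof (rule finite_subset)
  show "{(i, j). cf p i j \<noteq> 0} \<subseteq> Sigma {..degree p} (\<lambda>i. {..degree (coeff p i)})"
  proof clarsimp
    fix i j assume "cf p i j \<noteq> 0"
    then have "coeff p i \<noteq> 0" "coeff (coeff p i) j \<noteq> 0"
      by (auto simp: cf_def)
    then show "i \<le> degree p \<and> j \<le> degree (coeff p i)"
      by (simp add: le_degree)
  qed
qed auto

section \<open>Monomial ideals as upclosed sets of exponents\<close>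

lemma is_ideal_sum: "is_ideal I \<Longrightarrow> (\<And>x. x \<in> A \<Longrightarrow> f x \<in> I) \<Longrightarrow> sum f A \<in> I"
  by (induction A rule: infinite_finite_induct) (auto simp: is_ideal_def)

lemma is_ideal_ideal_gen: "is_ideal (ideal_gen S)"
  unfolding ideal_gen_def is_ideal_def by blast

lemma ideal_gen_superset: "S \<subseteq> ideal_gen S"
  unfolding ideal_gen_def by blast

lemma ideal_gen_minimal: "is_ideal I \<Longrightarrow> S \<subseteq> I \<Longrightarrow> ideal_gen S \<subseteq> I"
  unfolding ideal_gen_def by blast

lemma kscale_conv_mult: "kscale c p = kscale c 1 * p"
  by (simp add: kscale_def)

lemma is_ideal_kscale: "is_ideal I \<Longrightarrow> p \<in> I \<Longrightarrow> kscale c p \<in> I"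
  by (subst kscale_conv_mult) (auto simp: is_ideal_def)

lemma is_ideal_monomialwise:
  assumes "is_ideal I" "\<And>i j. cf p i j \<noteq> 0 \<Longrightarrow> xymon i j \<in> I"
  shows "p \<in> I"
proof -
  have "kscale (cf p i j) (xymon i j) \<in> I" for i j
  proof (cases "cf p i j = 0")
    case True
    then have "kscale (cf p i j) (xymon i j) = 0"
      by (simp add: kscale_def)
    with assms(1) show ?thesis
      by (simp add: is_ideal_def)
  qed (use assms in \<open>simp add: is_ideal_kscale\<close>)
  with assms(1) have "(\<Sum>i\<le>degree p. \<Sum>j\<le>degree (coeff p i). kscale (cf p i j) (xymon i j)) \<in> I"
    by (intro is_ideal_sum)
  then show ?thesis
    by (subst poly_poly_eq_sum_xymon)
qed

text \<open>Every monomial ideal has this form for an upclosed set, so membership and powers turn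
  into combinatorics of pairs of naturals.\<close>

definition supported :: "(nat \<times> nat) set \<Rightarrow> 'k::comm_ring_1 poly poly set" where
  "supported E = {p. \<forall>i j. cf p i j \<noteq> 0 \<longrightarrow> (i, j) \<in> E}"

definition upclosed :: "(nat \<times> nat) set \<Rightarrow> bool" where
  "upclosed E \<longleftrightarrow> (\<forall>(i, j)\<in>E. \<forall>a b. (i + a, j + b) \<in> E)"

lemma upclosedD:
  assumes "upclosed E" "(i, j) \<in> E" "i \<le> a" "j \<le> b"
  shows "(a, b) \<in> E"
proof -
  have "(i + (a - i), j + (b - j)) \<in> E"
    using assms(1,2) unfolding upclosed_def by blast
  with assms(3,4) show ?thesis
    by simp
qed

lemma xymon_in_supported_iff [simp]:
  "(xymon a b :: 'k::comm_ring_1 poly poly) \<in> supported E \<longleftrightarrow> (a, b) \<in> E"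
  by (auto simp: supported_def cf_xymon)

lemma is_ideal_supported:
  assumes "upclosed E"
  shows "is_ideal (supported E :: 'k::comm_ring_1 poly poly set)"
proof -
  have "(0 :: 'k poly poly) \<in> supported E"
    by (simp add: supported_def)
  moreover have "p + q \<in> supported E" if "p \<in> supported E" "q \<in> supported E" for p q :: "'k poly poly"
    using that unfolding supported_def by simp (metis add_0)
  moreover have "r * p \<in> supported E" if "p \<in> supported E" for p r :: "'k poly poly"
    unfolding supported_def
  proof clarify
    fix i j assume "cf (r * p) i j \<noteq> 0"
    then obtain a b c e where "cf p c e \<noteq> 0" "i = a + c" "j = b + e"
      by (rule cf_mult_nonzero)
    with that show "(i, j) \<in> E"
      using upclosedD[OF assms, of c e] by (simp add: supported_def)
  qed
  ultimately show ?thesis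
    unfolding is_ideal_def by blast
qed

lemma supported_eq_ideal_gen:
  assumes "upclosed E"
  shows "supported E = (ideal_gen ((\<lambda>(a, b). xymon a b) ` E) :: 'k::comm_ring_1 poly poly set)"
proof
  show "supported E \<subseteq> (ideal_gen ((\<lambda>(a, b). xymon a b) ` E) :: 'k poly poly set)"
  proof
    fix p :: "'k poly poly" assume "p \<in> supported E"
    show "p \<in> ideal_gen ((\<lambda>(a, b). xymon a b) ` E)"
    proof (rule is_ideal_monomialwise[OF is_ideal_ideal_gen])
      fix i j assume "cf p i j \<noteq> 0"
      with \<open>p \<in> supported E\<close> have "(xymon i j :: 'k poly poly) \<in> (\<lambda>(a, b). xymon a b) ` E"
        by (force simp: supported_def)
      then show "(xymon i j :: 'k poly poly) \<in> ideal_gen ((\<lambda>(a, b). xymon a b) ` E)"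
        by (rule subsetD[OF ideal_gen_superset])
    qed
  qed
  show "ideal_gen ((\<lambda>(a, b). xymon a b) ` E) \<subseteq> (supported E :: 'k poly poly set)"
    using assms by (intro ideal_gen_minimal is_ideal_supported) auto
qed

lemma monomial_ideal_supported:
  assumes "monomial_ideal (L :: 'k::comm_ring_1 poly poly set)"
  obtains E where "upclosed E" "L = supported E"
proof -
  from assms obtain S where S: "L = ideal_gen ((\<lambda>(a, b). xymon a b) ` S)"
    by (auto simp: monomial_ideal_def)
  define E where "E = {(i, j). \<exists>(a, b)\<in>S. a \<le> i \<and> b \<le> j}"
  have E: "upclosed E"
    unfolding upclosed_def E_def by (auto intro: trans_le_add1)
  have "L \<subseteq> supported E"
    unfolding S
  proof (rule ideal_gen_minimal[OF is_ideal_supported[OF E]])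
    show "(\<lambda>(a, b). xymon a b) ` S \<subseteq> supported E"
      by (force simp: E_def)
  qed
  moreover have "supported E \<subseteq> L"
    unfolding supported_eq_ideal_gen[OF E]
  proof (rule ideal_gen_minimal)
    show L: "is_ideal L"
      by (simp add: S is_ideal_ideal_gen)
    show "(\<lambda>(a, b). xymon a b) ` E \<subseteq> L"
    proof (clarsimp simp: E_def)
      fix i j a b assume *: "(a, b) \<in> S" "a \<le> i" "b \<le> j"
      then have "xymon a b \<in> L"
        unfolding S using ideal_gen_superset by fast
      with L have "xymon (i - a) (j - b) * xymon a b \<in> L"
        by (simp add: is_ideal_def)
      with * show "xymon i j \<in> L"
        by (simp add: xymon_mult)
    qed
  qed
  ultimately show thesis
    using that E by blast
qed

text \<open>The base case is \<open>UNIV\<close> and not the singleton of (0, 0): it mirrors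
  \<open>ideal_pow L 0\<close>, the whole ring.\<close>

fun sumset_pow :: "(nat \<times> nat) set \<Rightarrow> nat \<Rightarrow> (nat \<times> nat) set" where
  "sumset_pow E 0 = UNIV"
| "sumset_pow E (Suc n) = {(a + c, b + e) | a b c e. (a, b) \<in> E \<and> (c, e) \<in> sumset_pow E n}"

lemma sumset_powI: "(a, b) \<in> E \<Longrightarrow> (c, e) \<in> sumset_pow E n \<Longrightarrow> (a + c, b + e) \<in> sumset_pow E (Suc n)"
  by auto

lemma upclosed_sumset_pow: "upclosed E \<Longrightarrow> upclosed (sumset_pow E n)"
proof (induction n)
  case (Suc n)
  have "(a + c + i, b + e + j) \<in> sumset_pow E (Suc n)"
    if "(a, b) \<in> E" "(c, e) \<in> sumset_pow E n" for a b c e i j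
  proof -
    have "(c + i, e + j) \<in> sumset_pow E n"
      using Suc that by (auto intro: upclosedD)
    from sumset_powI[OF that(1) this] show ?thesis
      by (simp add: add.assoc)
  qed
  then show ?case
    unfolding upclosed_def by fastforce
qed (auto simp: upclosed_def)

lemma ideal_pow_supported:
  assumes "upclosed E"
  shows "ideal_pow (supported E :: 'k::comm_ring_1 poly poly set) n = supported (sumset_pow E n)"
proof (induction n)
  case 0
  then show ?case by (auto simp: supported_def)
next
  case (Suc n)
  let ?G = "{a * b |a b. a \<in> (supported E :: 'k poly poly set) \<and> b \<in> ideal_pow (supported E) n}"
  note up = upclosed_sumset_pow[OF assms, of "Suc n"]
  have "ideal_gen ?G \<subseteq> supported (sumset_pow E (Suc n))"
  proof (rule ideal_gen_minimal)
    show "?G \<subseteq> supported (sumset_pow E (Suc n))"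
    proof clarify
      fix p q :: "'k poly poly"
      assume pq: "p \<in> supported E" "q \<in> ideal_pow (supported E) n"
      show "p * q \<in> supported (sumset_pow E (Suc n))"
        unfolding supported_def
      proof clarify
        fix i j assume "cf (p * q) i j \<noteq> 0"
        then obtain a b c e where "cf p a b \<noteq> 0" "cf q c e \<noteq> 0" "i = a + c" "j = b + e"
          by (rule cf_mult_nonzero)
        moreover have "(a, b) \<in> E" "(c, e) \<in> sumset_pow E n"
          using pq calculation by (auto simp: Suc) (auto simp: supported_def)
        ultimately show "(i, j) \<in> sumset_pow E (Suc n)"
          using sumset_powI by blast
      qed
    qed
  qed (rule is_ideal_supported[OF up])
  moreover have "supported (sumset_pow E (Suc n)) \<subseteq> ideal_gen ?G"
    unfolding supported_eq_ideal_gen[OF up]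
  proof (rule ideal_gen_minimal)
    show "(\<lambda>(a, b). xymon a b) ` sumset_pow E (Suc n) \<subseteq> ideal_gen ?G"
    proof clarsimp
      fix a b c e assume *: "(a, b) \<in> E" "(c, e) \<in> sumset_pow E n"
      have "(xymon a b :: 'k poly poly) \<in> supported E"
        "(xymon c e :: 'k poly poly) \<in> ideal_pow (supported E) n"
        unfolding Suc using * by simp_all
      then have "xymon a b * xymon c e \<in> ?G"
        by blast
      then have "xymon a b * xymon c e \<in> ideal_gen ?G"
        by (rule subsetD[OF ideal_gen_superset])
      then show "xymon (a + c) (b + e) \<in> ideal_gen ?G"
        by (simp add: xymon_mult)
    qed
  qed (rule is_ideal_ideal_gen)
  ultimately show ?case
    by simp
qed

section \<open>Hilbert functions and uniqueness of Lex\<close>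

interpretation kscale: vector_space "kscale :: 'k::field \<Rightarrow> 'k poly poly \<Rightarrow> 'k poly poly"
  by unfold_locales (auto intro!: poly_poly_eqI simp: algebra_simps)

lemma is_ideal_subspace: "is_ideal I \<Longrightarrow> kscale.subspace (I :: 'k::field poly poly set)"
  unfolding kscale.subspace_def using is_ideal_kscale by (auto simp: is_ideal_def)

text \<open>Bridges indexed families, on which matrices act, and sets, on which dimension is
  counted: a repeated vector would satisfy a relation with coefficients 1 and -1, so triviality of
  all relations also yields injectivity.\<close>

lemma kscale_independent_family:
  fixes v :: "nat \<Rightarrow> 'k::field poly poly"
  assumes "finite A"
    and zero: "\<And>\<alpha> e. (\<Sum>e\<in>A. kscale (\<alpha> e) (v e)) = 0 \<Longrightarrow> e \<in> A \<Longrightarrow> \<alpha> e = 0"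
  shows "inj_on v A" "kscale.independent (v ` A)"
proof -
  show inj: "inj_on v A"
  proof (rule inj_onI, rule ccontr)
    fix x y assume xy: "x \<in> A" "y \<in> A" "v x = v y" "x \<noteq> y"
    define \<alpha> where "\<alpha> e = (if e = x then 1 else if e = y then -1 else 0 :: 'k)" for e
    have "(\<Sum>e\<in>A. kscale (\<alpha> e) (v e)) = (\<Sum>e\<in>{x, y}. kscale (\<alpha> e) (v e))"
      using xy \<open>finite A\<close> by (intro sum.mono_neutral_right) (auto simp: \<alpha>_def kscale_def)
    also have "\<dots> = 0"
      using xy by (intro poly_poly_eqI) (simp add: \<alpha>_def)
    finally have "\<alpha> x = 0"
      using zero xy(1) by blast
    then show False
      by (simp add: \<alpha>_def)
  qed
  show "kscale.independent (v ` A)"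
  proof (rule kscale.independent_if_scalars_zero)
    fix f x assume "(\<Sum>x\<in>v ` A. kscale (f x) x) = 0" "x \<in> v ` A"
    then show "f x = 0"
      using zero[of "\<lambda>e. f (v e)"] inj by (auto simp: sum.reindex)
  qed (use \<open>finite A\<close> in auto)
qed

lemma homogeneous_iff: "homogeneous s p \<longleftrightarrow> (\<forall>i j. cf p i j \<noteq> 0 \<longrightarrow> i + j = s)"
  by (simp add: homogeneous_def cf_def)

lemma homogeneous_xymon: "a + b = s \<Longrightarrow> homogeneous s (xymon a b)"
  by (auto simp: homogeneous_iff cf_xymon)

lemma homogeneous_eqI:
  assumes "homogeneous s p" "homogeneous s q" "\<And>i. i \<le> s \<Longrightarrow> cf p i (s - i) = cf q i (s - i)"
  shows "p = q"
proof (rule poly_poly_eqI)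
  fix i j
  show "cf p i j = cf q i j"
  proof (cases "i + j = s")
    case True
    then show ?thesis using assms(3)[of i] by auto
  next
    case False
    then show ?thesis using assms(1,2) by (metis homogeneous_iff)
  qed
qed

lemma homogeneous_sum: "(\<And>x. x \<in> A \<Longrightarrow> homogeneous s (f x)) \<Longrightarrow> homogeneous s (sum f A)"
  unfolding homogeneous_iff by (metis (no_types, lifting) cf_sum sum.neutral)

lemma homogeneous_kscale: "homogeneous s p \<Longrightarrow> homogeneous s (kscale c p)"
  unfolding homogeneous_iff by (metis cf_kscale mult_zero_right)

lemma homogeneous_mult:
  assumes "homogeneous s p" "homogeneous t q"
  shows "homogeneous (s + t) (p * q)"
  unfolding homogeneous_iff
proof clarify
  fix i j assume "cf (p * q) i j \<noteq> 0"
  then obtain a b c e where "cf p a b \<noteq> 0" "cf q c e \<noteq> 0" "i = a + c" "j = b + e"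
    by (rule cf_mult_nonzero)
  with assms show "i + j = s + t"
    by (fastforce simp: homogeneous_iff)
qed

lemma homogeneous_eq_sum_xymon:
  assumes "homogeneous s p"
  shows "p = (\<Sum>i\<le>s. kscale (cf p i (s - i)) (xymon i (s - i)))"
proof (rule homogeneous_eqI[OF assms])
  show "homogeneous s (\<Sum>i\<le>s. kscale (cf p i (s - i)) (xymon i (s - i)))"
    by (intro homogeneous_sum homogeneous_kscale homogeneous_xymon) simp
  fix i assume "i \<le> s"
  have "cf (\<Sum>i\<le>s. kscale (cf p i (s - i)) (xymon i (s - i))) i (s - i)
      = (\<Sum>k\<le>s. if k = i then cf p i (s - i) else 0)"
    unfolding cf_sum by (intro sum.cong refl) (auto simp: cf_xymon)
  also have "\<dots> = cf p i (s - i)"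
    using \<open>i \<le> s\<close> by simp
  finally show "cf p i (s - i) = cf (\<Sum>i\<le>s. kscale (cf p i (s - i)) (xymon i (s - i))) i (s - i)"
    by simp
qed

lemma xymon_family_independent:
  assumes "finite A"
  shows "inj_on (\<lambda>i. xymon i (s - i) :: 'k::field poly poly) A"
    "kscale.independent ((\<lambda>i. xymon i (s - i) :: 'k::field poly poly) ` A)"
proof -
  have *: "\<alpha> e = 0" if "(\<Sum>e\<in>A. kscale (\<alpha> e) (xymon e (s - e) :: 'k poly poly)) = 0" "e \<in> A" for \<alpha> e
  proof -
    have "0 = cf (\<Sum>e\<in>A. kscale (\<alpha> e) (xymon e (s - e) :: 'k poly poly)) e (s - e)"
      using that by simp
    also have "\<dots> = (\<Sum>k\<in>A. if k = e then \<alpha> e else 0)"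
      unfolding cf_sum by (intro sum.cong refl) (auto simp: cf_xymon)
    also have "\<dots> = \<alpha> e"
      using that assms by simp
    finally show ?thesis by simp
  qed
  show "inj_on (\<lambda>i. xymon i (s - i) :: 'k::field poly poly) A"
    using assms * by (rule kscale_independent_family(1))
  show "kscale.independent ((\<lambda>i. xymon i (s - i) :: 'k::field poly poly) ` A)"
    using assms * by (rule kscale_independent_family(2))
qed

lemma homogeneous_in_span:
  assumes "homogeneous s p" "\<And>i. i \<le> s \<Longrightarrow> cf p i (s - i) \<noteq> 0 \<Longrightarrow> i \<in> A"
  shows "(p :: 'k::field poly poly) \<in> kscale.span ((\<lambda>i. xymon i (s - i)) ` A)"
proof (subst homogeneous_eq_sum_xymon[OF assms(1)], rule kscale.span_sum)
  fix i assume "i \<in> {..s}"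
  then show "kscale (cf p i (s - i)) (xymon i (s - i)) \<in> kscale.span ((\<lambda>i. xymon i (s - i)) ` A)"
    by (cases "cf p i (s - i) = 0")
       (auto intro!: kscale.span_scale[OF kscale.span_base] assms(2) simp: kscale.span_zero)
qed

lemma hdim_supported:
  "hdim s (supported E :: 'k::field poly poly set) = card {i. i \<le> s \<and> (i, s - i) \<in> E}"
proof -
  let ?A = "{i. i \<le> s \<and> (i, s - i) \<in> E}"
  let ?B = "(\<lambda>i. xymon i (s - i) :: 'k poly poly) ` ?A"
  have "kscale.dim (graded_part s (supported E :: 'k poly poly set)) = card ?A"
  proof (rule kscale.dim_unique)
    show "?B \<subseteq> graded_part s (supported E)"
      by (auto simp: graded_part_def intro: homogeneous_xymon)
    show "graded_part s (supported E) \<subseteq> kscale.span ?B"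
      by (auto simp: graded_part_def supported_def intro!: homogeneous_in_span)
    show "kscale.independent ?B" "card ?B = card ?A"
      by (auto simp: card_image xymon_family_independent)
  qed
  then show ?thesis
    by (simp add: hdim_def)
qed

lemma hdim_le: "hdim s (I :: 'k::field poly poly set) \<le> Suc s"
proof -
  have "kscale.dim (graded_part s I) \<le> card ((\<lambda>i. xymon i (s - i) :: 'k poly poly) ` {..s})"
    by (rule kscale.dim_le_card) (auto simp: graded_part_def intro!: homogeneous_in_span)
  also have "\<dots> \<le> Suc s"
    using card_image_le[of "{..s}"] by simp
  finally show ?thesis
    by (simp add: hdim_def)
qed

lemma hdim_ge:
  assumes "finite B" "B \<subseteq> graded_part s I" "kscale.independent B"
  shows "card B \<le> hdim s (I :: 'k::field poly poly set)"
proof -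
  obtain B' where B': "B' \<subseteq> graded_part s I" "kscale.independent B'" "graded_part s I \<subseteq> kscale.span B'"
    "card B' = kscale.dim (graded_part s I)"
    by (rule kscale.basis_exists)
  \<comment> \<open>Finiteness of the basis \<open>B'\<close> has to come first, since
    \<open>card\<close> of an infinite set is 0; the monomials of degree s bound it.\<close>
  have "graded_part s I \<subseteq> kscale.span ((\<lambda>i. xymon i (s - i)) ` {..s})"
    by (auto simp: graded_part_def intro!: homogeneous_in_span)
  then have "finite B'"
    using kscale.independent_span_bound[of "(\<lambda>i. xymon i (s - i)) ` {..s}" B'] B' by blast
  then show ?thesis
    using kscale.independent_span_bound[of B' B] B' assms by (auto simp: hdim_def)
qed

text \<open>A monomial outside the span of a basis would enlarge it to s + 2 independent vectors
  inside a space spanned by s + 1 monomials.\<close>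

lemma hdim_full_imp_xymon:
  assumes "is_ideal I" "hdim s (I :: 'k::field poly poly set) = Suc s" "a + b = s"
  shows "xymon a b \<in> I"
proof -
  let ?T = "(\<lambda>i. xymon i (s - i) :: 'k poly poly) ` {..s}"
  obtain B where B: "B \<subseteq> graded_part s I" "kscale.independent B" "graded_part s I \<subseteq> kscale.span B"
    "card B = kscale.dim (graded_part s I)"
    by (rule kscale.basis_exists)
  have T: "p \<in> kscale.span ?T" if "homogeneous s p" for p
    using that by (intro homogeneous_in_span) auto
  have ab: "homogeneous s (xymon a b :: 'k poly poly)"
    using assms(3) by (intro homogeneous_xymon) auto
  have "xymon a b \<in> kscale.span B"
  proof (rule ccontr)
    assume *: "xymon a b \<notin> kscale.span B"
    then have "kscale.independent (insert (xymon a b) B)"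
      using B kscale.independent_insertI by blast
    moreover have "insert (xymon a b) B \<subseteq> kscale.span ?T"
      using B T ab by (auto simp: graded_part_def)
    ultimately have "finite (insert (xymon a b) B)" "card (insert (xymon a b) B) \<le> card ?T"
      using kscale.independent_span_bound[of ?T "insert (xymon a b) B"] by auto
    moreover have "card ?T \<le> Suc s"
      using card_image_le[of "{..s}"] by simp
    moreover have "card B = Suc s"
      using B assms(2) by (simp add: hdim_def)
    moreover have "xymon a b \<notin> B"
      using * kscale.span_base by blast
    ultimately show False
      by simp
  qed
  also have "kscale.span B \<subseteq> I"
    using B by (intro kscale.span_minimal is_ideal_subspace assms) (auto simp: graded_part_def)
  finally show ?thesis .
qed

lemma hdim_full_mono:
  assumes "is_ideal I" "hdim s (I :: 'k::field poly poly set) = Suc s" "s \<le> t"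
  shows "hdim t I = Suc t"
proof -
  let ?B = "(\<lambda>i. xymon i (t - i) :: 'k poly poly) ` {..t}"
  have "xymon i (t - i) \<in> I" if "i \<le> t" for i
  proof -
    \<comment> \<open>The degree s monomial x^a y^(s - a) with this a divides x^i y^(t - i).\<close>
    define a where "a = min i s"
    have "xymon a (s - a) \<in> I"
      using assms(1,2) by (rule hdim_full_imp_xymon) (simp add: a_def)
    with assms(1) have "xymon (i - a) (t - i - (s - a)) * xymon a (s - a) \<in> I"
      by (auto simp: is_ideal_def)
    moreover have "i - a + a = i" "t - i - (s - a) + (s - a) = t - i"
      using assms(3) that by (auto simp: a_def)
    ultimately show ?thesis
      by (simp add: xymon_mult)
  qed
  then have "?B \<subseteq> graded_part t I"
    by (auto simp: graded_part_def intro: homogeneous_xymon)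
  then have "card ?B \<le> hdim t I"
    by (intro hdim_ge) (simp_all add: xymon_family_independent)
  moreover have "card ?B = Suc t"
    by (simp add: card_image xymon_family_independent)
  ultimately show ?thesis
    using hdim_le[of t I] by simp
qed

text \<open>Upper subsets of an interval are comparable by inclusion, so their size determines them.
  This is what makes a lex-segment ideal unique for its Hilbert function.\<close>

lemma upset_eqI:
  fixes A B :: "nat set"
  assumes "A \<subseteq> {..s}" "B \<subseteq> {..s}" "card A = card B"
    and "\<And>a b. b \<in> A \<Longrightarrow> b < a \<Longrightarrow> a \<le> s \<Longrightarrow> a \<in> A"
    and "\<And>a b. b \<in> B \<Longrightarrow> b < a \<Longrightarrow> a \<le> s \<Longrightarrow> a \<in> B"
  shows "A = B"
proof -
  have fin: "finite A" "finite B"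
    using assms(1,2) finite_subset by auto
  have "A \<subseteq> B \<or> B \<subseteq> A"
  proof (rule ccontr)
    assume "\<not> ?thesis"
    then obtain x y where "x \<in> A" "x \<notin> B" "y \<in> B" "y \<notin> A"
      by blast
    moreover have "x \<le> s" "y \<le> s"
      using calculation assms(1,2) by auto
    ultimately show False
      using assms(4)[of x y] assms(5)[of y x] by (metis linorder_neqE_nat)
  qed
  then show ?thesis
    using assms(3) fin card_subset_eq by metis
qed

lemma lex_segment_unique:
  fixes L L' :: "'k::field poly poly set"
  assumes "lex_segment L" "lex_segment L'" "\<And>s. hdim s L = hdim s L'"
  shows "L = L'"
proof -
  have "monomial_ideal L" "monomial_ideal L'"
    using assms(1,2) by (simp_all add: lex_segment_def)
  then obtain E E' where E: "L = supported E" and E': "L' = supported E'"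
    by (elim monomial_ideal_supported)
  have "{i. i \<le> s \<and> (i, s - i) \<in> E} = {i. i \<le> s \<and> (i, s - i) \<in> E'}" for s
  proof (rule upset_eqI[of _ s])
    show "card {i. i \<le> s \<and> (i, s - i) \<in> E} = card {i. i \<le> s \<and> (i, s - i) \<in> E'}"
      using assms(3)[of s] by (simp add: E E' hdim_supported)
    show "a \<in> {i. i \<le> s \<and> (i, s - i) \<in> E}"
      if "b \<in> {i. i \<le> s \<and> (i, s - i) \<in> E}" "b < a" "a \<le> s" for a b
      using that assms(1) by (auto simp: E lex_segment_def)
    show "a \<in> {i. i \<le> s \<and> (i, s - i) \<in> E'}"
      if "b \<in> {i. i \<le> s \<and> (i, s - i) \<in> E'}" "b < a" "a \<le> s" for a b
      using that assms(2) by (auto simp: E' lex_segment_def)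
  qed auto
  then have "(i, j) \<in> E \<longleftrightarrow> (i, j) \<in> E'" for i j
    by (metis (no_types, lifting) add_diff_cancel_left' le_add1 mem_Collect_eq)
  then have "E = E'"
    by auto
  with E E' show ?thesis
    by simp
qed

lemma Lex_eqI:
  assumes "lex_segment L" "\<And>s. hdim s L = hdim s I"
  shows "Lex I = (L :: 'k::field poly poly set)"
  unfolding Lex_def
proof (rule the_equality)
  show "L' = L" if "lex_segment L' \<and> (\<forall>s. hdim s L' = hdim s I)" for L'
    using that assms by (intro lex_segment_unique) simp_all
qed (use assms in blast)

section \<open>The Hilbert function of generic forms\<close>

text \<open>The homogeneous component of degree s. The cofactors of an ideal combination of forms
  need not be homogeneous; taking components makes them so.\<close>

definition hcomp :: "nat \<Rightarrow> 'k::comm_ring_1 poly poly \<Rightarrow> 'k poly poly" where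
  "hcomp s p = (\<Sum>i\<le>s. kscale (cf p i (s - i)) (xymon i (s - i)))"

lemma homogeneous_hcomp: "homogeneous s (hcomp s p)"
  unfolding hcomp_def by (intro homogeneous_sum homogeneous_kscale homogeneous_xymon) simp

lemma cf_hcomp: "cf (hcomp s p) i j = (if i + j = s then cf p i j else 0)"
proof (cases "i + j = s")
  case True
  have "cf (hcomp s p) i j = (\<Sum>k\<le>s. if k = i then cf p i j else 0)"
    unfolding hcomp_def cf_sum using True by (intro sum.cong refl) (auto simp: cf_xymon)
  with True show ?thesis
    by simp
next
  case False
  with homogeneous_hcomp[of s p] show ?thesis
    by (auto simp: homogeneous_iff)
qed

lemma hcomp_homogeneous: "homogeneous s p \<Longrightarrow> hcomp s p = p"
  using homogeneous_eq_sum_xymon[of s p] by (simp add: hcomp_def)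

lemma hcomp_sum: "hcomp s (sum f A) = (\<Sum>x\<in>A. hcomp s (f x))"
  by (rule poly_poly_eqI) (simp add: cf_hcomp)

lemma hcomp_mult_homogeneous:
  assumes "homogeneous d f"
  shows "hcomp s (q * f) = (if d \<le> s then hcomp (s - d) q * f else 0)"
proof -
  have f: "cf f i j = 0" if "i + j \<noteq> d" for i j
    using assms that by (auto simp: homogeneous_iff)
  show ?thesis
  proof (cases "d \<le> s")
    case False
    have "cf (q * f) i j = 0" if "i + j = s" for i j
      unfolding cf_mult using that False by (intro sum.neutral ballI) (auto simp: f)
    with False show ?thesis
      by (auto intro!: poly_poly_eqI simp: cf_hcomp)
  next
    case True
    have "homogeneous (s - d + d) (hcomp (s - d) q * f)"
      using assms by (intro homogeneous_mult homogeneous_hcomp)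
    then have "hcomp s (q * f) = hcomp (s - d) q * f"
    proof (intro homogeneous_eqI[of s])
      fix i assume "i \<le> s"
      then have "cf (q * f) i (s - i) = cf (hcomp (s - d) q * f) i (s - i)"
        unfolding cf_mult using True
        by (intro sum.cong refl) (auto simp: cf_hcomp f)
      then show "cf (hcomp s (q * f)) i (s - i) = cf (hcomp (s - d) q * f) i (s - i)"
        using \<open>i \<le> s\<close> by (simp add: cf_hcomp)
    qed (use True in \<open>simp_all add: homogeneous_hcomp\<close>)
    with True show ?thesis
      by simp
  qed
qed

lemma cf_form_of: "cf (form_of d c i) a b = (if a + b = d i then c i a else 0)"
proof -
  have "cf (form_of d c i) a b = (\<Sum>j\<le>d i. if j = a then (if a + b = d i then c i a else 0) else 0)"
    unfolding form_of_def cf_sum by (intro sum.cong refl) (auto simp: cf_def)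
  then show ?thesis
    by auto
qed

lemma homogeneous_form_of: "homogeneous (d i) (form_of d c i)"
  by (auto simp: homogeneous_iff cf_form_of)

lemma ideal_gen_image_combination:
  assumes "p \<in> ideal_gen (f ` {..<r})"
  obtains q :: "nat \<Rightarrow> 'a::comm_ring_1" where "p = (\<Sum>i<r. q i * f i)"
proof -
  let ?I = "{\<Sum>i<r. q i * f i | q :: nat \<Rightarrow> 'a. True}"
  have "is_ideal ?I"
    unfolding is_ideal_def
  proof (intro conjI ballI allI)
    show "0 \<in> ?I"
      by (auto intro!: exI[of _ "\<lambda>_. 0"])
    fix a b assume "a \<in> ?I" "b \<in> ?I"
    then obtain q q' where "a = (\<Sum>i<r. q i * f i)" "b = (\<Sum>i<r. q' i * f i)"
      by auto
    then have "a + b = (\<Sum>i<r. (q i + q' i) * f i)"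
      by (simp add: sum.distrib distrib_right)
    then show "a + b \<in> ?I"
      by (auto intro!: exI[of _ "\<lambda>i. q i + q' i"])
  next
    fix a u assume "a \<in> ?I"
    then obtain q where "a = (\<Sum>i<r. q i * f i)"
      by auto
    then have "u * a = (\<Sum>i<r. (u * q i) * f i)"
      by (simp add: sum_distrib_left mult.assoc)
    then show "u * a \<in> ?I"
      by (auto intro!: exI[of _ "\<lambda>i. u * q i"])
  qed
  moreover have "f ` {..<r} \<subseteq> ?I"
  proof clarify
    fix k assume "k < r"
    then have "f k = (\<Sum>i<r. (if i = k then 1 else 0) * f i)"
      by (simp add: if_distrib[of "\<lambda>x. x * _"] cong: if_cong)
    then show "\<exists>q. f k = (\<Sum>i<r. q i * f i) \<and> True"
      by (intro exI[of _ "\<lambda>i. if i = k then 1 else 0"]) simp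
  qed
  ultimately have "p \<in> ?I"
    using assms ideal_gen_minimal by blast
  then show thesis
    using that by blast
qed

text \<open>In degree s each cofactor may be taken homogeneous of degree s - d i, so the s - d i + 1
  monomial multiples of each form span. Truncated subtraction gives 0 for forms of degree above
  s.\<close>

lemma hdim_forms_ideal_le:
  "hdim s (forms_ideal r d c :: 'k::field poly poly set) \<le> (\<Sum>i<r. Suc s - d i)"
proof -
  let ?f = "form_of d c :: nat \<Rightarrow> 'k poly poly"
  let ?S = "Sigma {..<r} (\<lambda>i. {..<Suc s - d i})"
  let ?T = "(\<lambda>(i, a). xymon a (s - d i - a) * ?f i) ` ?S"
  have "graded_part s (forms_ideal r d c) \<subseteq> kscale.span ?T"
  proof
    fix p :: "'k poly poly" assume p: "p \<in> graded_part s (forms_ideal r d c)"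
    then have "p \<in> ideal_gen (?f ` {..<r})"
      by (simp add: graded_part_def forms_ideal_def)
    then obtain q where q: "p = (\<Sum>i<r. q i * ?f i)"
      by (rule ideal_gen_image_combination)
    have "p = hcomp s p"
      using p by (simp add: graded_part_def hcomp_homogeneous)
    also have "\<dots> = (\<Sum>i<r. if d i \<le> s then hcomp (s - d i) (q i) * ?f i else 0)"
      unfolding q hcomp_sum by (simp add: hcomp_mult_homogeneous[OF homogeneous_form_of])
    also have "\<dots> \<in> kscale.span ?T"
    proof (intro kscale.span_sum)
      fix i assume i: "i \<in> {..<r}"
      have "hcomp (s - d i) (q i) * ?f i \<in> kscale.span ?T" if "d i \<le> s"
      proof -
        have "hcomp (s - d i) (q i) * ?f i
            = (\<Sum>a\<le>s - d i. kscale (cf (q i) a (s - d i - a)) (xymon a (s - d i - a) * ?f i))"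
          by (simp add: hcomp_def sum_distrib_right kscale_def)
        also have "\<dots> \<in> kscale.span ?T"
        proof (intro kscale.span_sum kscale.span_scale kscale.span_base)
          fix a assume "a \<in> {..s - d i}"
          then have "(i, a) \<in> ?S"
            using i that by auto
          then show "xymon a (s - d i - a) * ?f i \<in> ?T"
            by (rule rev_image_eqI) simp
        qed
        finally show ?thesis .
      qed
      then show "(if d i \<le> s then hcomp (s - d i) (q i) * ?f i else 0) \<in> kscale.span ?T"
        by (simp add: kscale.span_zero)
    qed
    finally show "p \<in> kscale.span ?T" .
  qed
  then have "hdim s (forms_ideal r d c :: 'k poly poly set) \<le> card ?T"
    unfolding hdim_def by (intro kscale.dim_le_card) auto
  also have "\<dots> \<le> card ?S"
    by (intro card_image_le) auto
  also have "\<dots> = (\<Sum>i<r. Suc s - d i)"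
    by simp
  finally show ?thesis .
qed

section \<open>Polynomial functions on the parameter space and maximal rank\<close>

lemma polyfun_sum: "(\<And>x. x \<in> A \<Longrightarrow> polyfun (f x)) \<Longrightarrow> polyfun (\<lambda>c. \<Sum>x\<in>A. f x c)"
  by (induction A rule: infinite_finite_induct) (auto intro: polyfun.intros)

lemma polyfun_prod: "(\<And>x. x \<in> A \<Longrightarrow> polyfun (f x)) \<Longrightarrow> polyfun (\<lambda>c. \<Prod>x\<in>A. f x c)"
  by (induction A rule: infinite_finite_induct) (auto intro: polyfun.intros)

lemma polyfun_on_line:
  assumes "polyfun f"
  shows "\<exists>p. \<forall>t. f (\<lambda>i j. a i j + t * b i j) = poly p t"
  using assms
proof induction
  case (pf_const x)
  show ?case by (rule exI[of _ "[:x:]"]) simp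
next
  case (pf_coord i j)
  show ?case by (rule exI[of _ "[:a i j, b i j:]"]) simp
next
  case (pf_add f g)
  then show ?case by (metis poly_add)
next
  case (pf_mult f g)
  then show ?case by (metis poly_mult)
qed

text \<open>Irreducibility of affine space, by restriction to the line through the two given points.\<close>

lemma polyfun_nonzero_common:
  fixes f g :: "(nat \<Rightarrow> nat \<Rightarrow> 'k::field_char_0) \<Rightarrow> 'k"
  assumes "polyfun f" "polyfun g"
    and a: "a \<in> param_space r d" "f a \<noteq> 0" and b: "b \<in> param_space r d" "g b \<noteq> 0"
  shows "\<exists>c\<in>param_space r d. f c * g c \<noteq> 0"
proof -
  define l where "l t = (\<lambda>i j. a i j + t * (b i j - a i j))" for t
  obtain p q where p: "\<And>t. f (l t) = poly p t" and q: "\<And>t. g (l t) = poly q t"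
    using polyfun_on_line[OF assms(1)] polyfun_on_line[OF assms(2)] unfolding l_def by metis
  have "l 0 = a" "l 1 = b"
    by (simp_all add: l_def)
  then have "p \<noteq> 0" "q \<noteq> 0"
    using a b p[of 0] q[of 1] by auto
  then have "finite {t. poly (p * q) t = 0}"
    by (intro poly_roots_finite) simp
  then obtain t where "poly (p * q) t \<noteq> 0"
    using ex_new_if_finite[OF infinite_UNIV_char_0] by blast
  then have "f (l t) * g (l t) \<noteq> 0"
    by (simp add: p q)
  moreover have "l t \<in> param_space r d"
    using a b by (simp add: param_space_def l_def)
  ultimately show ?thesis
    by blast
qed

lemma polyfun_nonzero_common_finite:
  fixes f :: "'a \<Rightarrow> (nat \<Rightarrow> nat \<Rightarrow> 'k::field_char_0) \<Rightarrow> 'k"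
  assumes "finite A" "\<And>x. x \<in> A \<Longrightarrow> polyfun (f x)"
    and "\<And>x. x \<in> A \<Longrightarrow> \<exists>c\<in>param_space r d. f x c \<noteq> 0"
  shows "\<exists>c\<in>param_space r d. (\<Prod>x\<in>A. f x c) \<noteq> 0"
  using assms
proof (induction A)
  case empty
  show ?case by (auto simp: param_space_def intro!: exI[of _ "\<lambda>_ _. 0"])
next
  case (insert x A)
  obtain a b where "a \<in> param_space r d" "f x a \<noteq> 0" "b \<in> param_space r d" "(\<Prod>x\<in>A. f x b) \<noteq> 0"
    using insert by (metis insert_iff)
  with polyfun_nonzero_common[of "f x" "\<lambda>c. \<Prod>x\<in>A. f x c"] show ?case
    using insert by (simp add: polyfun_prod)
qed

lemma polyfun_det:
  assumes "\<And>i j. polyfun (\<lambda>c. A c i j)"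
  shows "polyfun (\<lambda>c. det (mat n n (\<lambda>(i, j). A c i j)))"
proof -
  have "det (mat n n (\<lambda>(i, j). A c i j))
      = (\<Sum>p | p permutes {0..<n}. signof p * (\<Prod>i = 0..<n. A c i (p i)))" for c
    unfolding det_def by (auto intro!: sum.cong prod.cong simp: permutes_in_image)
  moreover have "polyfun (\<lambda>c. \<Sum>p | p permutes {0..<n}. signof p * (\<Prod>i = 0..<n. A c i (p i)))"
    by (intro polyfun_sum pf_mult pf_const polyfun_prod assms)
  ultimately show ?thesis
    by presburger
qed

text \<open>For a fixed degree s, the monomials x^(p i) y^(d i - p i) are chosen such that the
  x-exponents of their multiples of degree s fill consecutive intervals.\<close>

lemma consecutive_intervals:
  fixes d :: "nat \<Rightarrow> nat"
  obtains p where "\<And>i. p i \<le> d i"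
    "\<And>e. e < min (Suc s) (\<Sum>i<r. Suc s - d i) \<Longrightarrow> \<exists>i<r. \<exists>a<Suc s - d i. p i + a = e"
proof
  let ?F = "\<lambda>n. \<Sum>i<n. Suc s - d i"
  \<comment> \<open>The i-th interval starts where the earlier lengths end, capped at
    \<open>d i\<close> so that a monomial of degree \<open>d i\<close> exists. A capped interval
    runs from \<open>d i\<close> to s, hence still covers everything up to s.\<close>
  let ?p = "\<lambda>i. min (?F i) (d i)"
  show "?p i \<le> d i" for i
    by simp
  fix e assume e: "e < min (Suc s) (?F r)"
  define n where "n = (LEAST n. e < ?F n)"
  have n: "e < ?F n"
    unfolding n_def using e by (intro LeastI[of "\<lambda>n. e < ?F n" r]) simp
  have "n \<le> r"
    unfolding n_def using e by (intro Least_le) simp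
  moreover from n obtain i where i: "n = Suc i"
    by (cases n) auto
  moreover have "\<not> e < ?F i"
    using not_less_Least[of i "\<lambda>n. e < ?F n"] i by (simp add: n_def)
  moreover have "e < ?F i + (Suc s - d i)"
    using n i by simp
  ultimately show "\<exists>i<r. \<exists>a<Suc s - d i. ?p i + a = e"
    using e by (intro exI[of _ i] conjI exI[of _ "e - ?p i"]) auto
qed

text \<open>Semicontinuity of rank: \<open>D\<close> is a minor of the coefficient matrix of
  suitable multiples of the forms. Where it is nonzero these multiples are independent, and at a
  point given by monomials it is 1.\<close>

lemma max_rank_polyfun:
  fixes d :: "nat \<Rightarrow> nat"
  defines "N \<equiv> \<lambda>r s. min (Suc s) (\<Sum>i<r. Suc s - d i)"
  shows "\<exists>D :: (nat \<Rightarrow> nat \<Rightarrow> 'k::field) \<Rightarrow> 'k. polyfun D \<and> (\<exists>c\<in>param_space r d. D c \<noteq> 0) \<and>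
    (\<forall>c\<in>param_space r d. D c \<noteq> 0 \<longrightarrow> N r s \<le> hdim s (forms_ideal r d c))"
proof -
  let ?N = "N r s"
  obtain p where p: "\<And>i. p i \<le> d i" "\<And>e. e < ?N \<Longrightarrow> \<exists>i<r. \<exists>a<Suc s - d i. p i + a = e"
    unfolding N_def using consecutive_intervals[of d s r] by metis
  then obtain k a where ka: "\<And>e. e < ?N \<Longrightarrow> k e < r"
      "\<And>e. e < ?N \<Longrightarrow> a e < Suc s - d (k e)" "\<And>e. e < ?N \<Longrightarrow> p (k e) + a e = e"
    by metis
  define A :: "(nat \<Rightarrow> nat \<Rightarrow> 'k) \<Rightarrow> nat \<Rightarrow> nat \<Rightarrow> 'k" where
    "A c e' e = (if a e \<le> e' then c (k e) (e' - a e) else 0)" for c e' e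
  define M where "M c = mat ?N ?N (\<lambda>(e', e). A c e' e)" for c
  define v :: "(nat \<Rightarrow> nat \<Rightarrow> 'k) \<Rightarrow> nat \<Rightarrow> 'k poly poly" where
    "v c e = xymon (a e) (s - d (k e) - a e) * form_of d c (k e)" for c e
  have "polyfun (\<lambda>c. det (M c))"
    unfolding M_def
  proof (rule polyfun_det)
    show "polyfun (\<lambda>c. A c i j)" for i j
      unfolding A_def by (cases "a j \<le> i") (simp_all add: pf_const pf_coord)
  qed
  moreover have "\<exists>c\<in>param_space r d. det (M c) \<noteq> 0"
  proof
    \<comment> \<open>Here the i-th form is x^(p i) y^(d i - p i), so \<open>v c e\<close> becomes
      the monomial x^e y^(s - e) and the matrix the identity.\<close>
    define c where "c i j = (if i < r \<and> j = p i then 1 else 0 :: 'k)" for i j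
    show "c \<in> param_space r d"
      using p(1) by (auto simp: param_space_def c_def simp flip: not_le)
    have "M c = 1\<^sub>m ?N"
      unfolding M_def A_def c_def using ka(1,3) by (intro eq_matI) (fastforce simp: le_imp_diff_is_add)+
    then show "det (M c) \<noteq> 0"
      by simp
  qed
  moreover have "?N \<le> hdim s (forms_ideal r d c)" if c: "c \<in> param_space r d" "det (M c) \<noteq> 0" for c
  proof -
    have cf_v: "cf (v c e) e' (s - e') = A c e' e" if "e < ?N" "e' < ?N" for e e'
    proof -
      have "e' \<le> s" "k e < r" "a e < Suc s - d (k e)"
        using that ka by (auto simp: N_def)
      \<comment> \<open>\<open>A\<close> reads \<open>c\<close> without an upper range check, while
        \<open>form_of\<close> stops at \<open>d\<close>; the two agree because points of
        \<open>param_space\<close> vanish beyond \<open>d\<close>.\<close>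
      moreover have "c (k e) (e' - a e) = 0" if "d (k e) < e' - a e"
        using that c(1) by (simp add: param_space_def)
      ultimately show ?thesis
        unfolding v_def A_def cf_xymon_mult cf_form_of by auto
    qed
    have indep: "\<alpha> e = 0" if "(\<Sum>e<?N. kscale (\<alpha> e) (v c e)) = 0" "e \<in> {..<?N}" for \<alpha> e
    proof -
      \<comment> \<open>Entry e' of this product is the coefficient of x^e' y^(s - e') in the given
        relation.\<close>
      have "M c *\<^sub>v vec ?N \<alpha> = 0\<^sub>v ?N"
      proof (rule eq_vecI)
        fix e' assume "e' < dim_vec (0\<^sub>v ?N :: 'k vec)"
        then have e': "e' < ?N"
          by simp
        have "(M c *\<^sub>v vec ?N \<alpha>) $ e' = (\<Sum>e<?N. A c e' e * \<alpha> e)"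
          using e' by (simp add: M_def scalar_prod_def lessThan_atLeast0)
        also have "\<dots> = cf (\<Sum>e<?N. kscale (\<alpha> e) (v c e)) e' (s - e')"
          using e' by (simp add: cf_v mult.commute)
        finally show "(M c *\<^sub>v vec ?N \<alpha>) $ e' = 0\<^sub>v ?N $ e'"
          using that e' by simp
      qed (simp add: M_def)
      then have "vec ?N \<alpha> = 0\<^sub>v ?N"
        using c(2) det_0_iff_vec_prod_zero_field[of "M c" ?N]
        by (metis M_def mat_carrier vec_carrier)
      then show ?thesis
        using that(2) by (metis index_vec index_zero_vec(1) lessThan_iff)
    qed
    have family: "inj_on (v c) {..<?N}" "kscale.independent (v c ` {..<?N})"
      using kscale_independent_family[of "{..<?N}" "v c"] indep by blast+
    have "v c e \<in> graded_part s (forms_ideal r d c)" if "e < ?N" for e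
    proof -
      have "form_of d c (k e) \<in> forms_ideal r d c"
        unfolding forms_ideal_def using ka(1)[OF that] by (intro subsetD[OF ideal_gen_superset]) simp
      then have "v c e \<in> forms_ideal r d c"
        using is_ideal_ideal_gen unfolding v_def forms_ideal_def is_ideal_def by blast
      moreover have "homogeneous (a e + (s - d (k e) - a e) + d (k e)) (v c e)"
        unfolding v_def by (intro homogeneous_mult homogeneous_xymon homogeneous_form_of refl)
      moreover have "a e + (s - d (k e) - a e) + d (k e) = s"
        using ka(2)[OF that] by simp
      ultimately show ?thesis
        by (simp add: graded_part_def)
    qed
    then have "card (v c ` {..<?N}) \<le> hdim s (forms_ideal r d c)"
      using family(2) by (intro hdim_ge) auto
    then show ?thesis
      using family(1) by (simp add: card_image)
  qed
  ultimately show ?thesis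
    by blast
qed

lemma hdim_forms_ideal_full:
  assumes "hdim s (forms_ideal r d c :: 'k::field poly poly set) = Suc s" "s \<le> t"
  shows "hdim t (forms_ideal r d c) = Suc t"
  using assms hdim_full_mono is_ideal_ideal_gen unfolding forms_ideal_def by blast

text \<open>The first two forms already contribute 2 (s + 1) - d 0 - d 1 multiples, which is at
  least s + 1 in these degrees.\<close>

lemma full_degree_bound:
  fixes d :: "nat \<Rightarrow> nat" and r :: nat
  assumes "2 \<le> r" "d 0 + d 1 \<le> s"
  shows "Suc s \<le> (\<Sum>i<r. Suc s - d i)"
proof -
  have "Suc s \<le> (\<Sum>i\<in>{0, 1}. Suc s - d i)"
    using assms(2) by auto
  also have "\<dots> \<le> (\<Sum>i<r. Suc s - d i)"
    using assms(1) by (intro sum_mono2) auto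
  finally show ?thesis .
qed

lemma generic_hdim:
  fixes U :: "(nat \<Rightarrow> nat \<Rightarrow> 'k::field_char_0) set"
  assumes "2 \<le> r" "zariski_open (param_space r d) U" "U \<noteq> {}"
  obtains c where "c \<in> U"
    "\<And>s. hdim s (forms_ideal r d c) = min (Suc s) (\<Sum>i<r. Suc s - d i)"
proof -
  let ?P = "param_space r d :: (nat \<Rightarrow> nat \<Rightarrow> 'k) set"
  let ?N = "\<lambda>s. min (Suc s) (\<Sum>i<r. Suc s - d i)"
  let ?S = "d 0 + d 1"
  obtain F where F: "\<forall>f\<in>F. polyfun f" "?P - U = {c \<in> ?P. \<forall>f\<in>F. f c = 0}" and U: "U \<subseteq> ?P"
    using assms(2) by (auto simp: zariski_open_def zariski_closed_def)
  obtain c0 where "c0 \<in> U"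
    using assms(3) by blast
  \<comment> \<open>Nonvanishing of this single equation of the complement already forces a
    parameter into \<open>U\<close>.\<close>
  then obtain f0 where f0: "f0 \<in> F" "f0 c0 \<noteq> 0"
    using F(2) U by blast
  obtain D :: "nat \<Rightarrow> (nat \<Rightarrow> nat \<Rightarrow> 'k) \<Rightarrow> 'k" where D: "\<And>s. polyfun (D s)"
    "\<And>s. \<exists>c\<in>?P. D s c \<noteq> 0" "\<And>s c. c \<in> ?P \<Longrightarrow> D s c \<noteq> 0 \<Longrightarrow> ?N s \<le> hdim s (forms_ideal r d c)"
    using max_rank_polyfun[of r d] by metis
  have "\<exists>c\<in>?P. (\<Prod>s\<le>?S. D s c) \<noteq> 0"
    by (rule polyfun_nonzero_common_finite) (auto simp: D)
  then obtain c1 where c1: "c1 \<in> ?P" "(\<Prod>s\<le>?S. D s c1) \<noteq> 0"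
    by blast
  have "\<exists>c\<in>?P. f0 c * (\<Prod>s\<le>?S. D s c) \<noteq> 0"
  proof (rule polyfun_nonzero_common)
    show "polyfun f0" "c0 \<in> ?P" "f0 c0 \<noteq> 0"
      using f0 F(1) \<open>c0 \<in> U\<close> U by auto
    show "polyfun (\<lambda>c. \<Prod>s\<le>?S. D s c)"
      by (intro polyfun_prod D)
  qed (use c1 in auto)
  then obtain c where c: "c \<in> ?P" "f0 c * (\<Prod>s\<le>?S. D s c) \<noteq> 0"
    by blast
  have le: "hdim s (forms_ideal r d c) = ?N s" if "s \<le> ?S" for s
    using D(3)[of c s] c that hdim_le[of s "forms_ideal r d c"] hdim_forms_ideal_le[of s r d c] by force
  have ge: "hdim s (forms_ideal r d c) = ?N s" if "?S \<le> s" for s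
    using le[of ?S] hdim_forms_ideal_full[of ?S r d c s] full_degree_bound[OF assms(1), of d] that
    by (simp add: min_def)
  show thesis
  proof
    show "c \<in> U"
      using c F f0 by auto
    show "hdim s (forms_ideal r d c) = ?N s" for s
      using le ge by (cases "s \<le> ?S") auto
  qed
qed

section \<open>Powers of lex-segment ideals with concave Hilbert function\<close>

text \<open>The monomials of L in degree s are the x^i y^(s-i) with i \<ge> g (s - d), where d is the
  initial degree; g is concave on [0, M - 1] and vanishes from M on.\<close>

locale concave_staircase =
  fixes d M :: nat and g :: "nat \<Rightarrow> nat"
  assumes g_le: "g 0 \<le> d"
    and g_antimono: "s \<le> t \<Longrightarrow> g t \<le> g s"
    and M_pos: "0 < M"
    and g_M: "g M = 0"
    and g_pos: "0 < t \<Longrightarrow> t < M \<Longrightarrow> 0 < g t"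
    and g_concave: "p' \<le> p \<Longrightarrow> p' \<le> q \<Longrightarrow> p' + q' = p + q \<Longrightarrow> 0 < g q' \<Longrightarrow>
      g p' + g q' \<le> g p + g q"
begin

definition E :: "(nat \<times> nat) set" where
  "E = {(i, j). d \<le> i + j \<and> g (i + j - d) \<le> i}"

lemma upclosed_E: "upclosed E"
proof -
  have "(i + a, j + b) \<in> E" if "(i, j) \<in> E" for i j a b
  proof -
    have "g (i + a + (j + b) - d) \<le> g (i + j - d)"
      by (rule g_antimono) simp
    with that show ?thesis
      by (auto simp: E_def)
  qed
  then show ?thesis
    by (auto simp: upclosed_def)
qed

lemma sum_list_g_le: "sum_list (map g ts) \<le> length ts * d"
proof (induction ts)
  case (Cons t ts)
  then show ?case
    using g_antimono[of 0 t] g_le by simp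
qed simp

text \<open>The entry t of \<open>ts\<close> is the excess over d of the degree of one factor, and
  \<open>g t\<close> the x-exponent which that factor requires. The sum is merely bounded by the
  degree because surplus can be absorbed by upward closure.\<close>

lemma sumset_pow_E_iff:
  "(i, j) \<in> sumset_pow E n \<longleftrightarrow>
    (\<exists>ts. length ts = n \<and> n * d + sum_list ts \<le> i + j \<and> sum_list (map g ts) \<le> i)"
proof (induction n arbitrary: i j)
  case 0
  show ?case by simp
next
  case (Suc n)
  show ?case
  proof
    assume "(i, j) \<in> sumset_pow E (Suc n)"
    then obtain a b c e where *: "i = a + c" "j = b + e" "(a, b) \<in> E" "(c, e) \<in> sumset_pow E n"
      by auto
    with Suc obtain ts where "length ts = n" "n * d + sum_list ts \<le> c + e" "sum_list (map g ts) \<le> c"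
      by auto
    with * show "\<exists>ts. length ts = Suc n \<and> Suc n * d + sum_list ts \<le> i + j \<and> sum_list (map g ts) \<le> i"
      by (intro exI[of _ "(a + b - d) # ts"]) (auto simp: E_def)
  next
    assume "\<exists>ts. length ts = Suc n \<and> Suc n * d + sum_list ts \<le> i + j \<and> sum_list (map g ts) \<le> i"
    then obtain ts' where ts': "length ts' = Suc n" "Suc n * d + sum_list ts' \<le> i + j"
      "sum_list (map g ts') \<le> i"
      by blast
    from ts'(1) obtain t ts where "ts' = t # ts"
      by (auto simp: length_Suc_conv)
    with ts' have ts: "length ts = n" "Suc n * d + t + sum_list ts \<le> i + j"
      "g t + sum_list (map g ts) \<le> i"
      by auto
    \<comment> \<open>Greedy choice: the first factor takes as much x as its degree allows while
      leaving the others what they require. Either it is a pure power of x, or the rest needs at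
      most n d in x, which leaves enough y for \<open>b\<close>.\<close>
    define a where "a = min (d + t) (i - sum_list (map g ts))"
    define b where "b = d + t - a"
    have "g t \<le> a"
      using g_antimono[of 0 t] g_le ts(3) by (auto simp: a_def)
    then have ab: "(a, b) \<in> E"
      by (auto simp: E_def b_def a_def)
    have "a \<le> i"
      by (simp add: a_def)
    moreover have "b \<le> j"
      using sum_list_g_le[of ts] ts by (auto simp: a_def b_def min_def)
    moreover have "(i - a, j - b) \<in> sumset_pow E n"
      unfolding Suc using ts calculation by (intro exI[of _ ts]) (auto simp: a_def b_def)
    ultimately show "(i, j) \<in> sumset_pow E (Suc n)"
      using sumset_powI[OF ab, of "i - a" "j - b" n] by simp
  qed
qed

text \<open>By concavity, two parts strictly between 0 and M - 1 may be spread until one of them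
  reaches 0 or M - 1.\<close>

lemma remove_zero_part:
  assumes "length ts = Suc n" "sum_list ts \<le> n * (M - 1)"
  shows "\<exists>us. length us = n \<and> sum_list us \<le> sum_list ts \<and>
    sum_list (map g us) + g 0 \<le> sum_list (map g ts)"
  using assms
proof (induction n arbitrary: ts)
  case 0
  then show ?case by (auto simp: length_Suc_conv)
next
  case (Suc n)
  consider "0 \<in> set ts" | t where "t \<in> set ts" "M - 1 \<le> t" | "\<forall>t\<in>set ts. 0 < t \<and> t < M - 1"
    by (metis gr0I not_le)
  then show ?case
  proof cases
    case 1
    with Suc.prems show ?thesis
      using sum_list_map_remove1[OF 1, of g] sum_list_map_remove1[OF 1, of id]
      by (intro exI[of _ "remove1 0 ts"]) (auto simp: length_remove1)
  next
    case 2
    \<comment> \<open>Setting aside a part of size at least M - 1 lowers the permitted total by M -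
      1 along with the number of parts, so induction applies to the rest.\<close>
    have "sum_list ts = t + sum_list (remove1 t ts)"
      "sum_list (map g ts) = g t + sum_list (map g (remove1 t ts))"
      using sum_list_map_remove1[OF 2(1), of g] sum_list_map_remove1[OF 2(1), of id] by auto
    moreover obtain us where "length us = n" "sum_list us \<le> sum_list (remove1 t ts)"
      "sum_list (map g us) + g 0 \<le> sum_list (map g (remove1 t ts))"
      using Suc.IH[of "remove1 t ts"] Suc.prems 2 calculation by (auto simp: length_remove1)
    ultimately show ?thesis
      by (intro exI[of _ "t # us"]) auto
  next
    case 3
    obtain p q rest where ts: "ts = p # q # rest" "length rest = n"
      using Suc.prems(1) by (auto simp: length_Suc_conv)
    have pq: "0 < p" "p < M - 1" "0 < q" "q < M - 1"
      using 3 by (auto simp: ts)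
    show ?thesis
    proof (cases "p + q \<le> M - 1")
      case True
      \<comment> \<open>The pair is spread to 0 and p + q, and the 0 is the part to be
        removed.\<close>
      then have "g 0 + g (p + q) \<le> g p + g q"
        using pq by (intro g_concave g_pos) auto
      with ts show ?thesis
        by (intro exI[of _ "(p + q) # rest"]) auto
    next
      case False
      \<comment> \<open>The pair is spread until one part is M - 1, which is then set aside as in
        the previous case.\<close>
      then have "g (p + q - (M - 1)) + g (M - 1) \<le> g p + g q"
        using pq by (intro g_concave g_pos) auto
      moreover obtain us where "length us = n" "sum_list us \<le> p + q - (M - 1) + sum_list rest"
        "sum_list (map g us) + g 0 \<le> g (p + q - (M - 1)) + sum_list (map g rest)"
        using Suc.IH[of "(p + q - (M - 1)) # rest"] Suc.prems False ts by fastforce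
      ultimately show ?thesis
        using False ts by (intro exI[of _ "(M - 1) # us"]) auto
    qed
  qed
qed

lemma remove_large_part:
  assumes "length ts = Suc n" "sum_list ts \<le> t + M" "n * (M - 1) \<le> t"
  shows "\<exists>us. length us = n \<and> sum_list us \<le> t \<and> sum_list (map g us) \<le> sum_list (map g ts)"
proof -
  obtain a rest where ts: "ts = a # rest" "length rest = n"
    using assms(1) by (auto simp: length_Suc_conv)
  \<comment> \<open>Padding one part brings the total to exactly t + M and, as g is antitone, does
    not raise the sum of the g-values.\<close>
  define a' where "a' = t + M - sum_list rest"
  let ?ts = "a' # rest"
  have sum: "sum_list ?ts = t + M" and "a \<le> a'"
    using assms(2) ts by (auto simp: a'_def)
  then have le: "sum_list (map g ?ts) \<le> sum_list (map g ts)"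
    using g_antimono[of a a'] ts by simp
  have "\<exists>x\<in>set ?ts. M \<le> x"
  proof (rule ccontr)
    assume "\<not> ?thesis"
    then have "sum_list ?ts \<le> (\<Sum>x\<leftarrow>?ts. M - 1)"
      by (intro sum_list_mono[of ?ts "\<lambda>x. x", simplified map_ident]) fastforce
    also have "\<dots> = n * (M - 1) + (M - 1)"
      using ts(2) by (simp add: sum_list_triv)
    finally show False
      using sum assms(3) M_pos by linarith
  qed
  then obtain x where x: "x \<in> set ?ts" "M \<le> x"
    by blast
  have "sum_list (remove1 x ?ts) \<le> t" "sum_list (map g (remove1 x ?ts)) \<le> sum_list (map g ?ts)"
    using sum_list_map_remove1[OF x(1), of g] sum_list_map_remove1[OF x(1), of id] x(2) sum by auto
  moreover have "length (remove1 x ?ts) = n"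
    using x(1) ts(2) length_remove1[of x ?ts] by (simp del: remove1.simps)
  ultimately show ?thesis
    using le by (metis le_trans)
qed

text \<open>The summands realise a part 0, requiring x-exponent \<open>g 0\<close>, and a part M,
  requiring none: the two kinds of part that the removal lemmas can split off.\<close>

definition u :: "'k::comm_ring_1 poly poly" where
  "u = xymon (g 0) (d - g 0) + xymon 0 (d + M)"

lemma generators_in_E: "(g 0, d - g 0) \<in> E" "(0, d + M) \<in> E"
  using g_le by (auto simp: E_def g_M)

lemma u_in_supported: "u \<in> supported E"
  using generators_in_E by (auto simp: u_def supported_def cf_xymon)

text \<open>The multiplier x^(g 0) y^(d - g 0) only moves a monomial outside L^n into L^(n+1) in degrees
  above n (d + M - 1), the multiplier y^(d + M) only in degrees below. Applied to the monomials of
  least and of largest degree in f outside L^n, where no cancellation can occur, this is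
  contradictory.\<close>

lemma supported_colon_u:
  fixes f :: "'k::comm_ring_1 poly poly"
  assumes uf: "u * f \<in> supported (sumset_pow E (Suc n))"
  shows "f \<in> supported (sumset_pow E n)"
proof (rule ccontr)
  assume nf: "f \<notin> supported (sumset_pow E n)"
  define B where "B = {(i, j). cf f i j \<noteq> 0} - sumset_pow E n"
  define w where "w = (\<lambda>(i :: nat, j). i + j)"
  have B: "finite (w ` B)" "w ` B \<noteq> {}"
    using finite_cf_support[of f] nf by (auto simp: B_def supported_def)
  obtain i j where min: "(i, j) \<in> B" "w (i, j) = Min (w ` B)"
    using Min_in[OF B] by fastforce
  obtain i' j' where max: "(i', j') \<in> B" "w (i', j') = Max (w ` B)"
    using Max_in[OF B] by fastforce
  have min_le: "i + j \<le> a + b" if "(a, b) \<in> B" for a b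
    using min Min_le[OF B(1), of "w (a, b)"] that by (auto simp: w_def)
  have max_ge: "a + b \<le> i' + j'" if "(a, b) \<in> B" for a b
    using max Max_ge[OF B(1), of "w (a, b)"] that by (auto simp: w_def)
  have cf_u: "cf (u * f) a b = (if g 0 \<le> a \<and> d - g 0 \<le> b then cf f (a - g 0) (b - (d - g 0)) else 0)
      + (if d + M \<le> b then cf f a (b - (d + M)) else 0)" for a b
    by (simp add: u_def distrib_right cf_xymon_mult)
  have uf': "(a, b) \<in> sumset_pow E (Suc n)" if "cf (u * f) a b \<noteq> 0" for a b
    using uf that by (simp add: supported_def)
  have cases: "cf f a b = 0 \<or> (a, b) \<in> B \<or> (a, b) \<in> sumset_pow E n" for a b
    by (auto simp: B_def)

  have "(i + g 0, j + (d - g 0)) \<in> sumset_pow E (Suc n)"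
  \<comment> \<open>The other summand of \<open>u\<close> reaches this exponent from a monomial of
    degree i + j - M, below the minimum. If f contains that monomial, it lies in L^n and its
    multiple by y^(d + M) in L^(n+1); otherwise the coefficient of \<open>u * f\<close> here is that
    of f at (i, j).\<close>
  proof (cases "d + M \<le> j + (d - g 0) \<and> cf f (i + g 0) (j + (d - g 0) - (d + M)) \<noteq> 0")
    case True
    then have "(i + g 0, j + (d - g 0) - (d + M)) \<in> sumset_pow E n"
      using cases[of "i + g 0" "j + (d - g 0) - (d + M)"]
        min_le[of "i + g 0" "j + (d - g 0) - (d + M)"] M_pos g_le by auto
    from sumset_powI[OF generators_in_E(2) this] True show ?thesis
      by (simp del: sumset_pow.simps)
  next
    case False
    then have "cf (u * f) (i + g 0) (j + (d - g 0)) = cf f i j"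
      by (auto simp: cf_u)
    with min(1) show ?thesis
      by (intro uf') (auto simp: B_def)
  qed
  then obtain ts where ts: "length ts = Suc n" "Suc n * d + sum_list ts \<le> i + j + d"
    "sum_list (map g ts) \<le> i + g 0"
    using g_le by (auto simp: sumset_pow_E_iff simp del: sumset_pow.simps)
  \<comment> \<open>In smaller degree a part could be dropped that frees \<open>g 0\<close> of
    x-exponent, exactly what the multiplier added, and (i, j) would lie in L^n.\<close>
  have low: "n * d + n * (M - 1) < i + j"
  proof (rule ccontr)
    assume "\<not> ?thesis"
    with ts obtain us where "length us = n" "sum_list us \<le> sum_list ts"
      "sum_list (map g us) + g 0 \<le> sum_list (map g ts)"
      using remove_zero_part[of ts n] by auto
    with ts have "(i, j) \<in> sumset_pow E n"
      by (auto simp: sumset_pow_E_iff intro!: exI[of _ us])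
    with min(1) show False
      by (simp add: B_def)
  qed

  have "(i', j' + (d + M)) \<in> sumset_pow E (Suc n)"
  \<comment> \<open>Mirror image: the competing monomial has degree i' + j' + M, above the
    maximum.\<close>
  proof (cases "g 0 \<le> i' \<and> cf f (i' - g 0) (j' + (d + M) - (d - g 0)) \<noteq> 0")
    case True
    then have "(i' - g 0, j' + (d + M) - (d - g 0)) \<in> sumset_pow E n"
      using cases[of "i' - g 0" "j' + (d + M) - (d - g 0)"]
        max_ge[of "i' - g 0" "j' + (d + M) - (d - g 0)"] M_pos g_le by auto
    from sumset_powI[OF generators_in_E(1) this] True show ?thesis
      by (simp del: sumset_pow.simps)
  next
    case False
    then have "cf (u * f) i' (j' + (d + M)) = cf f i' j'"
      by (auto simp: cf_u)
    with max(1) show ?thesis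
      by (intro uf') (auto simp: B_def)
  qed
  then obtain ts' where ts': "length ts' = Suc n" "Suc n * d + sum_list ts' \<le> i' + j' + (d + M)"
    "sum_list (map g ts') \<le> i'"
    by (auto simp: sumset_pow_E_iff add.assoc simp del: sumset_pow.simps)
  \<comment> \<open>This carries the lower bound from the least degree over to the largest one,
    where it lets a part of size at least M be removed.\<close>
  have "i + j \<le> i' + j'"
    by (rule min_le[OF max(1)])
  with low ts' obtain us where "length us = n" "sum_list us \<le> i' + j' - n * d"
    "sum_list (map g us) \<le> sum_list (map g ts')"
    using remove_large_part[of ts' n "i' + j' - n * d"] by fastforce
  with ts' low \<open>i + j \<le> i' + j'\<close> have "(i', j') \<in> sumset_pow E n"
    by (auto simp: sumset_pow_E_iff intro!: exI[of _ us])
  with max(1) show False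
    by (simp add: B_def)
qed

end

section \<open>From the colon condition to a regular element of the associated graded ring\<close>

lemma depth_gr_posI:
  fixes L :: "'k::comm_ring_1 poly poly set"
  assumes "is_ideal L" "u \<in> L" "1 \<notin> L"
    and colon: "\<And>n f. u * f \<in> ideal_pow L (Suc n) \<Longrightarrow> f \<in> ideal_pow L n"
  shows "depth_gr_pos L"
proof -
  \<comment> \<open>The initial form of u in L/L^2: multiplication by it shifts degrees by one, so
    regularity can be tested in each degree separately.\<close>
  define v where "v n = (if n = 1 then u else 0)" for n :: nat
  have ideal: "is_ideal (ideal_pow L n)" for n
    by (cases n) (auto simp: is_ideal_ideal_gen is_ideal_def[of UNIV])
  then have zero: "0 \<in> ideal_pow L n" for n
    by (simp add: is_ideal_def)
  have "u * 1 \<in> ideal_pow L 1"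
    using assms(2) by (simp del: mult_1_right) (intro subsetD[OF ideal_gen_superset], blast)
  then have u1: "u \<in> ideal_pow L 1"
    by simp
  have L1: "ideal_pow L 1 \<subseteq> L"
    using assms(1) unfolding One_nat_def ideal_pow.simps
    by (intro ideal_gen_minimal) (auto simp: is_ideal_def mult.commute)
  have "gr_elem L v"
    unfolding gr_elem_def
  proof
    show "\<forall>n. v n \<in> ideal_pow L n"
      using u1 zero by (simp add: v_def del: ideal_pow.simps)
    have "v n \<in> ideal_pow L (Suc n)" if "n \<noteq> 1" for n
      unfolding v_def using that by (simp only: if_False zero)
    then have "{n. v n \<notin> ideal_pow L (Suc n)} \<subseteq> {1}"
      by blast
    then show "finite {n. v n \<notin> ideal_pow L (Suc n)}"
      by (rule finite_subset) simp
  qed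
  moreover have "v 0 \<in> max_ideal"
    using is_ideal_ideal_gen[of "{varX, varY}"] unfolding v_def max_ideal_def is_ideal_def by auto
  ultimately have "v \<in> gr_max L"
    by (simp add: gr_max_def)
  have mult: "gr_mult v a (Suc n) = u * a n" "gr_mult v a 0 = 0" for a n
  proof -
    have "gr_mult v a (Suc n) = (\<Sum>i\<le>Suc n. if i = 1 then u * a (Suc n - i) else 0)"
      unfolding gr_mult_def by (intro sum.cong) (auto simp: v_def)
    then show "gr_mult v a (Suc n) = u * a n"
      by simp
    show "gr_mult v a 0 = 0"
      by (simp add: gr_mult_def v_def)
  qed
  have "gr_regular L v"
    unfolding gr_regular_def
  proof (intro conjI allI impI)
    fix a assume "gr_elem L a \<and> gr_zero L (gr_mult v a)"
    then have "gr_mult v a (Suc n) \<in> ideal_pow L (Suc (Suc n))" for n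
      unfolding gr_zero_def gr_eq_def by (metis diff_zero)
    then show "gr_zero L a"
      unfolding gr_zero_def gr_eq_def mult using colon by (metis diff_zero)
  next
    \<comment> \<open>The identity of the graded ring is not a multiple of \<open>v\<close>: such
      multiples vanish in degree 0, whereas 1 is not in L. Thus the quotient by \<open>v\<close> is
      nonzero.\<close>
    let ?one = "\<lambda>n :: nat. if n = 0 then 1 else 0 :: 'k poly poly"
    have "gr_elem L ?one"
      unfolding gr_elem_def
    proof
      have "?one n \<in> ideal_pow L (Suc n)" if "n \<noteq> 0" for n
        using that by (simp only: if_False zero)
      then have "{n. ?one n \<notin> ideal_pow L (Suc n)} \<subseteq> {0}"
        by blast
      then show "finite {n. ?one n \<notin> ideal_pow L (Suc n)}"
        by (rule finite_subset) simp
    qed (use zero in auto)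
    moreover have "\<not> gr_eq L ?one (gr_mult v h)" for h
    proof
      assume "gr_eq L ?one (gr_mult v h)"
      then have "?one 0 - gr_mult v h 0 \<in> ideal_pow L (Suc 0)"
        unfolding gr_eq_def by blast
      with L1 assms(3) show False
        by (auto simp: mult)
    qed
    ultimately show "\<exists>a. gr_elem L a \<and> \<not> (\<exists>h. gr_elem L h \<and> gr_eq L a (gr_mult v h))"
      by blast
  qed
  with \<open>v \<in> gr_max L\<close> show ?thesis
    unfolding depth_gr_pos_def by blast
qed

lemma (in concave_staircase) depth_gr_pos_supported:
  assumes "0 < d"
  shows "depth_gr_pos (supported E :: 'k::comm_ring_1 poly poly set)"
proof (rule depth_gr_posI)
  show "is_ideal (supported E :: 'k poly poly set)"
    by (rule is_ideal_supported[OF upclosed_E])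
  show "(1 :: 'k poly poly) \<notin> supported E"
    using assms by (simp flip: xymon_0_0 add: E_def)
qed (auto simp: ideal_pow_supported[OF upclosed_E] simp del: ideal_pow.simps sumset_pow.simps
    intro: u_in_supported supported_colon_u)

lemma one_notin_max_ideal: "(1 :: 'k::field poly poly) \<notin> max_ideal"
proof -
  let ?E = "{(i, j). 0 < i + j} :: (nat \<times> nat) set"
  have "is_ideal (supported ?E :: 'k poly poly set)"
    by (rule is_ideal_supported) (auto simp: upclosed_def)
  moreover have "{varX, varY} \<subseteq> (supported ?E :: 'k poly poly set)"
    by (auto simp: supported_def varX_def varY_def cf_def split: if_splits)
  ultimately have "max_ideal \<subseteq> (supported ?E :: 'k poly poly set)"
    unfolding max_ideal_def by (rule ideal_gen_minimal)
  moreover have "(1 :: 'k poly poly) \<notin> supported ?E"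
    by (simp flip: xymon_0_0)
  ultimately show ?thesis
    by blast
qed

lemma m_primary_proper: "m_primary (I :: 'k::field poly poly set) \<Longrightarrow> 1 \<notin> I"
  using one_notin_max_ideal unfolding m_primary_def radical_def
  by (metis (mono_tags, lifting) mem_Collect_eq power_one)

theorem theorem5p3:
  fixes L :: "'k::field_char_0 poly poly set"
  assumes "alg_closed_field TYPE('k)"
    and "generic_lex L"
  shows "depth_gr_pos L"
proof -
  obtain r d U where r: "2 \<le> r" and U: "zariski_open (param_space r d) U" "U \<noteq> {}"
    "\<And>c. c \<in> U \<Longrightarrow> m_primary (forms_ideal r d c)" "\<And>c. c \<in> U \<Longrightarrow> L = Lex (forms_ideal r d c)"
    using assms(2) unfolding generic_lex_def by blast
  define F where "F s = (\<Sum>i<r. Suc s - d i)" for s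
  \<comment> \<open>L is the same for all parameters in \<open>U\<close>, so it may be computed at
    one point of maximal rank.\<close>
  obtain c where c: "c \<in> U" and hdim: "\<And>s. hdim s (forms_ideal r d c) = min (Suc s) (F s)"
    using generic_hdim[OF r U(1,2)] unfolding F_def by metis
  define D where "D = Min (d ` {..<r})"
  have D_le: "D \<le> d i" if "i < r" for i
    unfolding D_def using that by auto
  have "D \<in> d ` {..<r}"
    unfolding D_def using r by (intro Min_in) (auto simp: lessThan_empty_iff)
  then obtain m where m: "m < r" "d m = D"
    by auto
  have F_Suc: "F s < F (Suc s)" if "D \<le> s" for s
    unfolding F_def using m that by (intro sum_strict_mono_ex1) (auto intro!: bexI[of _ m])
  have F_0: "F s = 0" if "s < D" for s
    unfolding F_def using that D_le by force
  have F_D: "0 < F D"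
    unfolding F_def using m by (intro sum_pos2[of _ m]) auto
  \<comment> \<open>Each summand, the positive part of s + 1 - d i, is convex in s.\<close>
  have F_convex: "F p + F q \<le> F p' + F q'" if "p' \<le> p" "p' \<le> q" "p' + q' = p + q" for p q p' q'
    unfolding F_def sum.distrib[symmetric] using that by (intro sum_mono) arith

  \<comment> \<open>A form of degree 0 would make degree 0 full and put 1 into an ideal whose
    radical is the maximal ideal.\<close>
  have D_pos: "0 < D"
  proof (rule ccontr)
    assume "\<not> 0 < D"
    then have "hdim 0 (forms_ideal r d c) = Suc 0"
      using F_D hdim[of 0] by simp
    then have "xymon 0 0 \<in> forms_ideal r d c"
      by (intro hdim_full_imp_xymon[of _ 0]) (auto simp: forms_ideal_def is_ideal_ideal_gen)
    with m_primary_proper[OF U(3)[OF c]] show False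
      by (simp add: xymon_0_0)
  qed

  define g where "g t = Suc (D + t) - F (D + t)" for t
  \<comment> \<open>Requiring 0 < t gives M = 1 when g 0 = 0, so that M - 1 is a genuine
    predecessor.\<close>
  define M where "M = (LEAST t. 0 < t \<and> g t = 0)"
  have "0 < Suc (d 0 + d 1) \<and> g (Suc (d 0 + d 1)) = 0"
    using full_degree_bound[OF r, of d "D + Suc (d 0 + d 1)"] by (simp add: g_def F_def)
  then have M: "0 < M" "g M = 0"
    unfolding M_def using LeastI[of "\<lambda>t. 0 < t \<and> g t = 0"] by blast+
  have g_antimono: "g t \<le> g s" if "s \<le> t" for s t
  proof (rule lift_Suc_antimono_le[OF _ that])
    show "g (Suc n) \<le> g n" for n
      using F_Suc[of "D + n"] by (simp add: g_def)
  qed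
  interpret concave_staircase D M g
  proof
    show "g 0 \<le> D"
      using F_D by (simp add: g_def)
    show "g t \<le> g s" if "s \<le> t" for s t
      using that by (rule g_antimono)
    show "0 < g t" if "0 < t" "t < M" for t
      using not_less_Least[of t "\<lambda>t. 0 < t \<and> g t = 0"] that by (auto simp: M_def)
    show "g p' + g q' \<le> g p + g q" if *: "p' \<le> p" "p' \<le> q" "p' + q' = p + q" "0 < g q'" for p p' q q'
    proof -
      \<comment> \<open>Both values on the left are now untruncated, while truncation on the right
        can only increase them, so convexity of \<open>F\<close> suffices.\<close>
      have "0 < g p'"
        using g_antimono[of p' q'] * by simp
      with * F_convex[of "D + p'" "D + p" "D + q" "D + q'"] show ?thesis
        unfolding g_def by linarith
    qed
  qed (use M in auto)

  have "lex_segment (supported E :: 'k poly poly set)"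
    unfolding lex_segment_def monomial_ideal_def
    using supported_eq_ideal_gen[OF upclosed_E] by (auto simp: E_def)
  moreover have "hdim s (supported E :: 'k poly poly set) = hdim s (forms_ideal r d c)" for s
  proof (cases "D \<le> s")
    case True
    \<comment> \<open>Truncated subtraction gives this interval exactly min (Suc s) (F s) elements,
      also when \<open>F s\<close> exceeds s + 1.\<close>
    then have "{i. i \<le> s \<and> (i, s - i) \<in> E} = {Suc s - F s..s}"
      by (auto simp: E_def g_def)
    then show ?thesis
      by (simp add: hdim_supported hdim)
  next
    case False
    then have "{i. i \<le> s \<and> (i, s - i) \<in> E} = {}"
      by (auto simp: E_def)
    with False show ?thesis
      by (simp add: hdim_supported hdim F_0)
  qed
  ultimately have "Lex (forms_ideal r d c) = supported E"
    by (rule Lex_eqI)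
  with U(4)[OF c] show ?thesis
    using depth_gr_pos_supported[OF D_pos] by simp
qed

end
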